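(* Let $\mathbf{Q}$ be a quantale, $X,Y$ two non-empty sets and $p\in Q^{X\times Y}$. Let $H_p:Q^X\to Q^Y$ and $\Lambda_p:Q^Y\to Q^X$ be defined by $$H_pf(y)=\bigvee_{x\in X}f(x)\cdot p(x,y)\quad(y\in Y),\qquad \Lambda_pg(x)=\bigwedge_{y\in Y}g(y)/p(x,y)\quad(x\in X).$$ Then: (i) $(H_p,\Lambda_p)$ is an adjoint pair, i.e. $H_p$ is a residuated map and $\Lambda_p=(H_p)_*$ is its residual: $H_pf\le g\iff f\le\Lambda_pg$; (ii) $H_p$ is a homomorphism of left $\mathbf{Q}$-modules from $\mathbf{Q}^X$ to $\mathbf{Q}^Y$, and $\Lambda_p$ is a homomorphism of right $\mathbf{Q}$-modules from $(\mathbf{Q}^Y)^{\mathrm{op}}$ to $(\mathbf{Q}^X)^{\mathrm{op}}$; (iii) $\Lambda_p\circ H_p$ is a nucleus on $\mathbf{Q}^X$, and $H_p\circ\Lambda_p$ is a nucleus on $(\mathbf{Q}^Y)^{\mathrm{op}}$.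
   Context: A quantale $\mathbf{Q}=\langle Q,\vee,\cdot,\bot,e\rangle$ is a complete lattice with a monoid structure $\langle Q,\cdot,e\rangle$ whose product distributes over arbitrary joins in both arguments; its divisions are given by $x\cdot y\le z\iff x\le z/y\iff y\le x\backslash z$. A left $\mathbf{Q}$-module is a complete lattice $\mathbf{M}$ (viewed as a sup-lattice) with $\star:Q\times M\to M$ preserving arbitrary joins in each argument, with $(q_1q_2)\star m=q_1\star(q_2\star m)$ and $e\star m=m$; right modules are analogous. Homomorphisms preserve arbitrary joins and scalar multiplication. $\mathbf{Q}^X$ is the left $\mathbf{Q}$-module $Q^X$ with pointwise joins and scalar multiplication $(q\star f)(x)=q\cdot f(x)$. For a left module $\mathbf{M}$, the dual $\mathbf{M}^{\mathrm{op}}$ is the right $\mathbf{Q}$-module on $M$ with reversed order and scalar multiplication by $q$ sending $m$ to $q\backslash_\star m=\bigvee\{n\in M\mid q\star n\le m\}$ (join in $\mathbf{M}$). A nucleus on a module is an order preserving, extensive, idempotent map $\gamma$ with $q\star\gamma(m)\le\gamma(q\star m)$ (for right modules, with the scalar acting on the right), all with respect to the order of that module. *)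

theory Defs
  imports Main "HOL-Library.Dual_Ordered_Lattice"
begin

subsection \<open>Adjoint pairs\<close>

definition adjoint_pair :: "('a::order \<Rightarrow> 'b::order) \<Rightarrow> ('b \<Rightarrow> 'a) \<Rightarrow> bool"
  where "adjoint_pair f g \<longleftrightarrow> (\<forall>x y. f x \<le> y \<longleftrightarrow> x \<le> g y)"

definition residuated :: "('a::order \<Rightarrow> 'b::order) \<Rightarrow> bool"
  where "residuated f \<longleftrightarrow> (\<exists>g. adjoint_pair f g)"

definition residual :: "('a::order \<Rightarrow> 'b::order) \<Rightarrow> 'b \<Rightarrow> 'a"
  where "residual f = (THE g. adjoint_pair f g)"

lemma adjoint_pair_unique:
  assumes "adjoint_pair f g" "adjoint_pair f h"
  shows "g = h"
  using assms unfolding adjoint_pair_def by (intro ext antisym) blast+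

lemma residual_adjoint:
  assumes "residuated f"
  shows "adjoint_pair f (residual f)"
  using assms adjoint_pair_unique unfolding residuated_def residual_def
  by (metis (no_types, lifting) theI)

subsection \<open>Quantales\<close>

text \<open>The distributivity laws cover the empty join, so that \<open>bot\<close> is absorbing.\<close>

class quantale = complete_lattice + monoid_mult +
  assumes Sup_mult: "Sup A * y = Sup ((\<lambda>x. x * y) ` A)"
    and mult_Sup: "x * Sup B = Sup ((\<lambda>y. x * y) ` B)"

definition rdiv :: "'q::quantale \<Rightarrow> 'q \<Rightarrow> 'q"  (infixl "\<sslash>" 70)
  where "z \<sslash> y = Sup {x. x * y \<le> z}"

lemma rdiv_galois: "x \<le> z \<sslash> y \<longleftrightarrow> x * y \<le> z"
  for x y z :: "'q::quantale"
proof
  assume le: "x \<le> z \<sslash> y"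
  have "x * y \<le> (z \<sslash> y) * y"
  proof -
    have "(z \<sslash> y) * y = Sup {x, z \<sslash> y} * y"
      using le by (simp add: sup.absorb2)
    also have "\<dots> = sup (x * y) ((z \<sslash> y) * y)"
      by (subst Sup_mult) simp
    finally show ?thesis
      by (simp add: le_iff_sup)
  qed
  also have "\<dots> \<le> z"
    unfolding rdiv_def Sup_mult by (auto intro: SUP_least)
  finally show "x * y \<le> z" .
next
  assume "x * y \<le> z"
  then show "x \<le> z \<sslash> y"
    unfolding rdiv_def by (intro Sup_upper) simp
qed

subsection \<open>Quantale modules\<close>

locale left_qmodule =
  fixes scale :: "'q::quantale \<Rightarrow> 'm::complete_lattice \<Rightarrow> 'm"
  assumes Sup_scale: "scale (Sup A) m = (SUP q\<in>A. scale q m)"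
    and scale_Sup: "scale q (Sup B) = (SUP m\<in>B. scale q m)"
    and scale_mult: "scale (q1 * q2) m = scale q1 (scale q2 m)"
    and scale_one: "scale 1 m = m"

locale right_qmodule =
  fixes scale :: "'m::complete_lattice \<Rightarrow> 'q::quantale \<Rightarrow> 'm"
  assumes scale_Sup: "scale m (Sup A) = (SUP q\<in>A. scale m q)"
    and Sup_scale: "scale (Sup B) q = (SUP m\<in>B. scale m q)"
    and scale_mult: "scale m (q1 * q2) = scale (scale m q1) q2"
    and scale_one: "scale m 1 = m"

locale left_qmodule_hom =
  dom: left_qmodule scale1 + cod: left_qmodule scale2
  for scale1 :: "'q::quantale \<Rightarrow> 'm::complete_lattice \<Rightarrow> 'm"
    and scale2 :: "'q \<Rightarrow> 'n::complete_lattice \<Rightarrow> 'n" +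
  fixes h :: "'m \<Rightarrow> 'n"
  assumes hom_Sup: "h (Sup B) = (SUP m\<in>B. h m)"
    and hom_scale: "h (scale1 q m) = scale2 q (h m)"

locale right_qmodule_hom =
  dom: right_qmodule scale1 + cod: right_qmodule scale2
  for scale1 :: "'m::complete_lattice \<Rightarrow> 'q::quantale \<Rightarrow> 'm"
    and scale2 :: "'n::complete_lattice \<Rightarrow> 'q \<Rightarrow> 'n" +
  fixes h :: "'m \<Rightarrow> 'n"
  assumes hom_Sup: "h (Sup B) = (SUP m\<in>B. h m)"
    and hom_scale: "h (scale1 m q) = scale2 (h m) q"

locale left_qmodule_nucleus = left_qmodule scale
  for scale :: "'q::quantale \<Rightarrow> 'm::complete_lattice \<Rightarrow> 'm" +
  fixes \<gamma> :: "'m \<Rightarrow> 'm"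
  assumes nuc_mono: "mono \<gamma>"
    and nuc_extensive: "m \<le> \<gamma> m"
    and nuc_idem: "\<gamma> (\<gamma> m) = \<gamma> m"
    and nuc_scale: "scale q (\<gamma> m) \<le> \<gamma> (scale q m)"

locale right_qmodule_nucleus = right_qmodule scale
  for scale :: "'m::complete_lattice \<Rightarrow> 'q::quantale \<Rightarrow> 'm" +
  fixes \<gamma> :: "'m \<Rightarrow> 'm"
  assumes nuc_mono: "mono \<gamma>"
    and nuc_extensive: "m \<le> \<gamma> m"
    and nuc_idem: "\<gamma> (\<gamma> m) = \<gamma> m"
    and nuc_scale: "scale (\<gamma> m) q \<le> \<gamma> (scale m q)"

text \<open>
  The underlying complete lattice of the module \<open>M\<^sup>o\<^sup>p\<close> is the type of duals, whose order is
  reversed; the join in \<open>op_scale\<close> is formed in the original lattice. A map \<open>h\<close> of the original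
  lattices, regarded as a map between the dual lattices, is \<open>op_map h\<close>.
\<close>

definition op_scale ::
    "('q::quantale \<Rightarrow> 'm::complete_lattice \<Rightarrow> 'm) \<Rightarrow> 'm dual \<Rightarrow> 'q \<Rightarrow> 'm dual"
  where "op_scale scale m q = dual (Sup {n. scale q n \<le> undual m})"

definition op_map :: "('m \<Rightarrow> 'n) \<Rightarrow> 'm dual \<Rightarrow> 'n dual"
  where "op_map h = dual \<circ> h \<circ> undual"

text \<open>The scalar multiplication of the free module \<open>Q\<^sup>X\<close>, where \<open>X\<close> is the set of all
  elements of a type (hence non-empty); joins in \<open>Q\<^sup>X\<close> are those of the function type.\<close>

definition fun_scale :: "'q::quantale \<Rightarrow> ('x \<Rightarrow> 'q) \<Rightarrow> 'x \<Rightarrow> 'q"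
  where "fun_scale q f = (\<lambda>x. q * f x)"

lemma left_qmodule_fun_scale:
  "left_qmodule (fun_scale :: 'q::quantale \<Rightarrow> ('x \<Rightarrow> 'q) \<Rightarrow> 'x \<Rightarrow> 'q)"
  by standard (auto simp: fun_scale_def fun_eq_iff Sup_mult mult_Sup mult.assoc image_image)

subsection \<open>The transforms with a given kernel\<close>

definition H_trans :: "('x \<times> 'y \<Rightarrow> 'q::quantale) \<Rightarrow> ('x \<Rightarrow> 'q) \<Rightarrow> 'y \<Rightarrow> 'q"
  where "H_trans p f = (\<lambda>y. SUP x. f x * p (x, y))"

definition Lambda_trans :: "('x \<times> 'y \<Rightarrow> 'q::quantale) \<Rightarrow> ('y \<Rightarrow> 'q) \<Rightarrow> 'x \<Rightarrow> 'q"
  where "Lambda_trans p g = (\<lambda>x. INF y. g y \<sslash> p (x, y))"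

end

theory Submission
  imports Defs
begin

text \<open>
  The distributivity laws make \<open>H\<^sub>p\<close> a module homomorphism with residual \<open>\<Lambda>\<^sub>p\<close>; the rest holds
  for every residuated module homomorphism \<open>h\<close> with residual \<open>g\<close>. Since \<open>q \<star> n \<le> m \<longleftrightarrow> n \<le> q \ m\<close>,
  transposing \<open>h (q \<star> n) = q \<star> h n\<close> along both adjunctions gives \<open>g (q \ m) = q \ g m\<close>.
\<close>

text \<open>Divisions and residuals are known only through the elements below them in the original
  order. Comparing lower sets there turns each equation in a dual module into an equivalence that
  adjunctions can rewrite.\<close>

lemma dual_eq_lowerI:
  fixes a b :: "'a::order dual"
  assumes "\<And>n. n \<le> undual a \<longleftrightarrow> n \<le> undual b"
  shows "a = b"
  using assms by (metis dual_eqI antisym order_refl)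

context left_qmodule
begin

lemma scale_mono:
  assumes "m \<le> n"
  shows "scale q m \<le> scale q n"
proof -
  have "scale q n = scale q (Sup {m, n})"
    using assms by (simp add: sup.absorb2)
  also have "\<dots> = sup (scale q m) (scale q n)"
    by (subst scale_Sup) simp
  finally show ?thesis
    by (simp add: le_iff_sup)
qed

text \<open>As \<open>scale q\<close> preserves joins, the join that defines the division still
  satisfies the defining inequality. Hence division by \<open>q\<close> is right adjoint to
  \<open>scale q\<close>.\<close>

lemma le_undual_op_scale: "n \<le> undual (op_scale scale m q) \<longleftrightarrow> scale q n \<le> undual m"
proof
  assume "n \<le> undual (op_scale scale m q)"
  then have "scale q n \<le> scale q (Sup {n. scale q n \<le> undual m})"
    by (intro scale_mono) (simp add: op_scale_def image_image)
  also have "\<dots> \<le> undual m"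
    by (auto simp: scale_Sup intro: SUP_least)
  finally show "scale q n \<le> undual m" .
next
  assume "scale q n \<le> undual m"
  then show "n \<le> undual (op_scale scale m q)"
    by (simp add: op_scale_def image_image Sup_upper)
qed

lemma right_qmodule_op: "right_qmodule (op_scale scale)"
proof
  show "op_scale scale m (Sup A) = (SUP q\<in>A. op_scale scale m q)" for m A
    by (rule dual_eq_lowerI)
      (simp add: le_undual_op_scale Sup_scale le_INF_iff SUP_le_iff)
  show "op_scale scale (Sup B) q = (SUP m\<in>B. op_scale scale m q)" for B q
    by (rule dual_eq_lowerI) (simp add: le_undual_op_scale le_INF_iff)
  \<comment> \<open>Transposing moves \<open>q2\<close> onto \<open>n\<close> first and
    \<open>q1\<close> second, so the left action turns into a right one.\<close>
  show "op_scale scale m (q1 * q2) = op_scale scale (op_scale scale m q1) q2" for m q1 q2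
    by (rule dual_eq_lowerI) (simp add: le_undual_op_scale scale_mult)
  show "op_scale scale m 1 = m" for m
    by (rule dual_eq_lowerI) (simp add: le_undual_op_scale scale_one)
qed

end

lemma adjoint_pair_counit: "adjoint_pair f g \<Longrightarrow> f (g y) \<le> y"
  by (simp add: adjoint_pair_def)

lemma adjoint_pair_unit: "adjoint_pair f g \<Longrightarrow> x \<le> g (f x)"
  by (metis adjoint_pair_def order_refl)

lemma adjoint_pair_mono_left: "adjoint_pair f g \<Longrightarrow> mono f"
  by (rule monoI) (metis adjoint_pair_def adjoint_pair_unit order_trans)

lemma adjoint_pair_mono_right: "adjoint_pair f g \<Longrightarrow> mono g"
  by (rule monoI) (metis adjoint_pair_def adjoint_pair_counit order_trans)

text \<open>One inequality is the counit at \<open>f x\<close>, the other is \<open>f\<close>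
  applied to the unit.\<close>

lemma adjoint_pair_left_right_left: "adjoint_pair f g \<Longrightarrow> f (g (f x)) = f x"
  by (meson adjoint_pair_counit adjoint_pair_mono_left adjoint_pair_unit antisym monoD)

lemma adjoint_pair_residuated: "adjoint_pair f g \<Longrightarrow> residuated f"
  by (auto simp: residuated_def)

lemma adjoint_pair_residual: "adjoint_pair f g \<Longrightarrow> g = residual f"
  using adjoint_pair_residuated adjoint_pair_unique residual_adjoint by blast

context left_qmodule_hom
begin

context
  fixes g
  assumes adj: "adjoint_pair h g"
begin

lemma right_qmodule_hom_residual:
  "right_qmodule_hom (op_scale scale2) (op_scale scale1) (op_map g)"
proof -
  have le_g: "n \<le> g m \<longleftrightarrow> h n \<le> m" for n m
    using adj by (simp add: adjoint_pair_def)
  interpret dual_dom: right_qmodule "op_scale scale2"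
    by (rule cod.right_qmodule_op)
  interpret dual_cod: right_qmodule "op_scale scale1"
    by (rule dom.right_qmodule_op)
  show ?thesis
  proof
    \<comment> \<open>Joins of the dual are meets of the original order, which a right adjoint
      preserves.\<close>
    show "op_map g (Sup B) = (SUP m\<in>B. op_map g m)" for B
      by (rule dual_eq_lowerI) (simp add: op_map_def le_g le_INF_iff)
    show "op_map g (op_scale scale2 m q) = op_scale scale1 (op_map g m) q" for m q
      by (rule dual_eq_lowerI)
        (simp add: op_map_def le_g hom_scale dom.le_undual_op_scale cod.le_undual_op_scale)
  qed
qed

lemma left_qmodule_nucleus_residual: "left_qmodule_nucleus scale1 (g \<circ> h)"
proof
  show "mono (g \<circ> h)"
    using adj by (intro monoI) (simp add: adjoint_pair_mono_left adjoint_pair_mono_right monoD)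
  show "m \<le> (g \<circ> h) m" for m
    using adj by (simp add: adjoint_pair_unit)
  show "(g \<circ> h) ((g \<circ> h) m) = (g \<circ> h) m" for m
    using adj by (simp add: adjoint_pair_left_right_left)
  show "scale1 q ((g \<circ> h) m) \<le> (g \<circ> h) (scale1 q m)" for q m
  proof -
    \<comment> \<open>\<open>h\<close> does not distinguish \<open>g (h m)\<close> from
      \<open>m\<close>, and by linearity this survives scaling by \<open>q\<close>.\<close>
    have "h (scale1 q (g (h m))) = h (scale1 q m)"
      using adj by (simp add: hom_scale adjoint_pair_left_right_left)
    then show ?thesis
      using adjoint_pair_unit[OF adj, of "scale1 q (g (h m))"] by simp
  qed
qed

lemma right_qmodule_nucleus_residual:
  "right_qmodule_nucleus (op_scale scale2) (op_map (h \<circ> g))"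
proof -
  interpret right_qmodule "op_scale scale2"
    by (rule cod.right_qmodule_op)
  show ?thesis
  proof
    show "mono (op_map (h \<circ> g))"
      using adj by (intro monoI)
        (simp add: op_map_def dual_less_eq_iff adjoint_pair_mono_left adjoint_pair_mono_right monoD)
    show "m \<le> op_map (h \<circ> g) m" for m
      using adj by (simp add: op_map_def dual_less_eq_iff adjoint_pair_counit)
    show "op_map (h \<circ> g) (op_map (h \<circ> g) m) = op_map (h \<circ> g) m" for m
      using adj by (simp add: op_map_def adjoint_pair_left_right_left)
    show "op_scale scale2 (op_map (h \<circ> g) m) q \<le> op_map (h \<circ> g) (op_scale scale2 m q)" for m q
    proof -
      \<comment> \<open>\<open>?r\<close> is the largest \<open>n\<close> with
        \<open>scale2 q n \<le> undual m\<close>, and the counit puts \<open>h (g ?r)\<close> below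
        it.\<close>
      let ?r = "undual (op_scale scale2 m q)"
      have "scale2 q (h (g ?r)) \<le> undual m"
        using adjoint_pair_counit[OF adj] by (simp flip: cod.le_undual_op_scale)
      \<comment> \<open>Linearity moves \<open>q\<close> inside \<open>h\<close>. Transposing and
        then applying \<open>h\<close> again sharpens the bound \<open>undual m\<close> to
        \<open>h (g (undual m))\<close>.\<close>
      then have "scale1 q (g ?r) \<le> g (undual m)"
        using adj by (simp add: adjoint_pair_def flip: hom_scale)
      then have "scale2 q (h (g ?r)) \<le> h (g (undual m))"
        using adjoint_pair_mono_left[OF adj] by (simp add: monoD flip: hom_scale)
      then show ?thesis
        by (simp add: op_map_def dual_less_eq_iff cod.le_undual_op_scale)
    qed
  qed
qed

end

end

text \<open>Both inequalities unfold to \<open>f x * p (x, y) \<le> g y\<close> for all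
  \<open>x\<close> and \<open>y\<close>.\<close>

lemma adjoint_pair_H_trans: "adjoint_pair (H_trans p) (Lambda_trans p)"
  unfolding adjoint_pair_def H_trans_def Lambda_trans_def
  by (auto simp: le_fun_def SUP_le_iff le_INF_iff rdiv_galois)

text \<open>Joins pass through by interchanging two suprema. Scalars pass through by associativity,
  because they multiply on the left and the kernel on the right.\<close>

lemma left_qmodule_hom_H_trans: "left_qmodule_hom fun_scale fun_scale (H_trans p)"
proof (intro left_qmodule_hom.intro left_qmodule_fun_scale left_qmodule_hom_axioms.intro)
  show "H_trans p (Sup B) = (SUP f\<in>B. H_trans p f)" for B
    by (auto simp: H_trans_def fun_eq_iff Sup_mult image_image intro: SUP_commute)
  show "H_trans p (fun_scale q f) = fun_scale q (H_trans p f)" for q f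
    by (simp add: H_trans_def fun_scale_def fun_eq_iff mult_Sup image_image mult.assoc)
qed

theorem theorem4p4p3:
  fixes p :: "'x \<times> 'y \<Rightarrow> 'q::quantale"
  shows "(adjoint_pair (H_trans p) (Lambda_trans p) \<and>
          residuated (H_trans p) \<and> Lambda_trans p = residual (H_trans p)) \<and>
         (left_qmodule_hom fun_scale fun_scale (H_trans p) \<and>
          right_qmodule_hom (op_scale (fun_scale :: 'q \<Rightarrow> ('y \<Rightarrow> 'q) \<Rightarrow> 'y \<Rightarrow> 'q))
            (op_scale (fun_scale :: 'q \<Rightarrow> ('x \<Rightarrow> 'q) \<Rightarrow> 'x \<Rightarrow> 'q)) (op_map (Lambda_trans p))) \<and>
         (left_qmodule_nucleus fun_scale (Lambda_trans p \<circ> H_trans p) \<and>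
          right_qmodule_nucleus (op_scale (fun_scale :: 'q \<Rightarrow> ('y \<Rightarrow> 'q) \<Rightarrow> 'y \<Rightarrow> 'q))
            (op_map (H_trans p \<circ> Lambda_trans p)))"
  using adjoint_pair_H_trans[of p] left_qmodule_hom_H_trans[of p]
  by (intro conjI)
    (assumption | erule adjoint_pair_residuated | erule adjoint_pair_residual
      | rule left_qmodule_hom.right_qmodule_hom_residual
          left_qmodule_hom.left_qmodule_nucleus_residual
          left_qmodule_hom.right_qmodule_nucleus_residual)+

end
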